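(* Let $\lambda,\kappa\in\mathbf{k}$ and let $(R,P)$ be an extended Rota-Baxter algebra of weight $(\lambda,\kappa)$. Define $$x\prec_P y:=xP(y)+\lambda xy,\quad x\succ_P y:=P(x)y,\quad x,y\in R.$$ Then $(R,\prec_P,\succ_P)$ is an extended dendriform algebra.
   Context: $\mathbf{k}$ is a field of characteristic $0$; a $\mathbf{k}$-algebra is a nonunitary associative $\mathbf{k}$-algebra; all operations are bilinear. An extended Rota-Baxter algebra of weight $(\lambda,\kappa)$ is a pair $(R,P)$ of a $\mathbf{k}$-algebra $R$ and a $\mathbf{k}$-linear map $P:R\to R$ with $P(x)P(y)=P(xP(y))+P(P(x)y)+\lambda P(xy)+\kappa xy$ for all $x,y\in R$. An extended dendriform algebra is a vector space $A$ with two binary operations $\prec,\succ$ such that, with $\star:=\prec+\succ$, for all $x,y,z\in A$: $(x\prec y)\prec z+(x\star y)\succ z=x\prec(y\star z)+x\succ(y\succ z)$ and $(x\succ y)\prec z=x\succ(y\prec z)$. *)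

theory Defs
  imports Complex_Main
begin

definition bilinear_op :: "('k::field \<Rightarrow> 'a::ab_group_add \<Rightarrow> 'a) \<Rightarrow> ('a \<Rightarrow> 'a \<Rightarrow> 'a) \<Rightarrow> bool" where
  "bilinear_op scale f \<longleftrightarrow>
     (\<forall>x. Vector_Spaces.linear scale scale (\<lambda>y. f x y)) \<and>
     (\<forall>y. Vector_Spaces.linear scale scale (\<lambda>x. f x y))"

text \<open>Addition and the associative product come from the class \<^class>\<open>ring\<close>, which
  does not require a unit; the scalar action is the locale parameter.\<close>

locale nonunital_algebra = vector_space scale
  for scale :: "'k::field_char_0 \<Rightarrow> 'a::ring \<Rightarrow> 'a" +
  assumes mult_bilinear: "bilinear_op scale (\<lambda>x y. x * y)"

locale extended_Rota_Baxter_algebra = nonunital_algebra scale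
  for scale :: "'k::field_char_0 \<Rightarrow> 'a::ring \<Rightarrow> 'a" +
  fixes lam kappa :: 'k and P :: "'a \<Rightarrow> 'a"
  assumes P_linear: "Vector_Spaces.linear scale scale P"
    and P_mult: "P x * P y =
      P (x * P y) + P (P x * y) + scale lam (P (x * y)) + scale kappa (x * y)"

locale extended_dendriform_algebra = vector_space scale
  for scale :: "'k::field_char_0 \<Rightarrow> 'a::ab_group_add \<Rightarrow> 'a" +
  fixes prec succ :: "'a \<Rightarrow> 'a \<Rightarrow> 'a"
  assumes prec_bilinear: "bilinear_op scale prec"
    and succ_bilinear: "bilinear_op scale succ"
    and prec_succ_sum:
      "prec (prec x y) z + succ (prec x y + succ x y) z =
       prec x (prec y z + succ y z) + succ x (succ y z)"
    and succ_prec_assoc: "prec (succ x y) z = succ x (prec y z)"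

definition RB_prec :: "('k \<Rightarrow> 'a \<Rightarrow> 'a) \<Rightarrow> 'k \<Rightarrow> ('a \<Rightarrow> 'a) \<Rightarrow> 'a::ring \<Rightarrow> 'a \<Rightarrow> 'a" where
  "RB_prec scale lam P x y = x * P y + scale lam (x * y)"

definition RB_succ :: "('a \<Rightarrow> 'a) \<Rightarrow> 'a::ring \<Rightarrow> 'a \<Rightarrow> 'a" where
  "RB_succ P x y = P x * y"

end

theory Submission
  imports Defs
begin

text \<open>
  The reason for the theorem is that the extended Rota-Baxter identity computes \<open>P\<close> on the
  sum \<open>x \<star> y = x P(y) + P(x) y + \<lambda>xy\<close> of the two operations:
  \<open>P(x \<star> y) = P(x) P(y) - \<kappa>xy\<close>, so \<open>P\<close> fails to be multiplicative from \<open>\<star>\<close> to the given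
  product only by the term \<open>\<kappa>xy\<close>. In the first dendriform axiom \<open>P\<close> of such a
  sum occurs once on each side, as \<open>P(x \<star> y) z\<close> on the left and as \<open>x P(y \<star> z)\<close> on the
  right. By associativity the two defects \<open>-\<kappa>(xy)z\<close> and \<open>-\<kappa>x(yz)\<close> agree, and what
  remains on both sides is
  \<open>x P(y) P(z) + P(x) P(y) z + \<lambda>(x y P(z) + x P(y) z + \<lambda>xyz)\<close>.
  The second axiom holds because the left multiplication by \<open>P(x)\<close> is linear and commutes
  with the right multiplications by \<open>P(z)\<close> and by \<open>z\<close>.
\<close>

context extended_Rota_Baxter_algebra
begin

lemma mult_scale_right: "x * scale c y = scale c (x * y)"
  using mult_bilinear by (simp add: bilinear_op_def Vector_Spaces.linear_iff)

lemma mult_scale_left: "scale c x * y = scale c (x * y)"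
  using mult_bilinear by (simp add: bilinear_op_def Vector_Spaces.linear_iff)

lemma P_add: "P (x + y) = P x + P y"
  using P_linear by (simp add: Vector_Spaces.linear_iff)

lemma P_scale: "P (scale c x) = scale c (P x)"
  using P_linear by (simp add: Vector_Spaces.linear_iff)

lemma bilinear_RB_prec: "bilinear_op scale (RB_prec scale lam P)"
  using vector_space_axioms
  by (simp add: bilinear_op_def Vector_Spaces.linear_iff RB_prec_def P_add P_scale
      mult_scale_left mult_scale_right scale_right_distrib scale_left_commute[of lam]
      algebra_simps)

lemma bilinear_RB_succ: "bilinear_op scale (RB_succ P)"
  using vector_space_axioms
  by (simp add: bilinear_op_def Vector_Spaces.linear_iff RB_succ_def P_add P_scale
      mult_scale_left mult_scale_right algebra_simps)

text \<open>
  The Rota-Baxter identity read backwards. It lets \<open>P\<close> of a sum of dendriform products be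
  eliminated, leaving only products of elements and of their images under \<open>P\<close>.
\<close>

lemma P_prec_plus_succ:
  "P (RB_prec scale lam P x y + RB_succ P x y) = P x * P y - scale kappa (x * y)"
  by (simp add: RB_prec_def RB_succ_def P_mult P_add P_scale)

lemma RB_prec_succ_sum:
  "RB_prec scale lam P (RB_prec scale lam P x y) z
     + RB_succ P (RB_prec scale lam P x y + RB_succ P x y) z
   = RB_prec scale lam P x (RB_prec scale lam P y z + RB_succ P y z)
     + RB_succ P x (RB_succ P y z)"
proof -
  let ?prec = "RB_prec scale lam P" and ?succ = "RB_succ P"
  have left: "?succ (?prec x y + ?succ x y) z = P x * P y * z - scale kappa (x * y * z)"
    by (simp only: RB_succ_def[of P "_ + _"] P_prec_plus_succ)
       (simp add: left_diff_distrib mult_scale_left)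
  have right: "?prec x (?prec y z + ?succ y z)
      = x * P y * P z - scale kappa (x * y * z) + scale lam (x * (?prec y z + ?succ y z))"
    by (simp only: RB_prec_def[of _ _ _ _ "_ + _"] P_prec_plus_succ)
       (simp add: right_diff_distrib mult_scale_right mult.assoc)
  show ?thesis
    unfolding left right
    by (simp add: RB_prec_def RB_succ_def mult_scale_left mult_scale_right
        scale_right_distrib algebra_simps)
qed

lemma RB_succ_prec_assoc:
  "RB_prec scale lam P (RB_succ P x y) z = RB_succ P x (RB_prec scale lam P y z)"
  by (simp add: RB_prec_def RB_succ_def mult_scale_right distrib_left mult.assoc)

end

theorem theorem2p10:
  fixes scale :: "'k::field_char_0 \<Rightarrow> 'a::ring \<Rightarrow> 'a"
    and lam kappa :: 'k
    and P :: "'a \<Rightarrow> 'a"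
  assumes "extended_Rota_Baxter_algebra scale lam kappa P"
  shows "extended_dendriform_algebra scale (RB_prec scale lam P) (RB_succ P)"
proof -
  interpret extended_Rota_Baxter_algebra scale lam kappa P
    by (fact assms)
  show ?thesis
    by unfold_locales
       (fact bilinear_RB_prec bilinear_RB_succ RB_prec_succ_sum RB_succ_prec_assoc)+
qed

end
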